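(* Let $n\ge 3$, let $T=(T_1,\ldots,T_n)\in\mathbb{R}^n$ and let $t_1<\cdots<t_n$ be real numbers. Then the function $\mathcal{E}_\infty:(-\infty,0)\to[0,\infty)$, $\mathcal{E}_\infty(k)=\|\mathcal{F}_k-T\|_\infty$, is quasiconvex. Moreover, if $T$ does not have a maximum between two minima nor a minimum between two maxima, then $\mathcal{E}_\infty$ is strictly quasiconvex.
   Context: For $k<0$, $G_k$ is the linear span in $\mathbb{R}^n$ of $E=(e^{kt_1},\ldots,e^{kt_n})$ and $I=(1,\ldots,1)$, and $\mathcal{F}_k$ is the (existing and unique) best approximation to $T$ in $G_k$ with respect to $\|\cdot\|_\infty$, i.e. the unique element of $G_k$ with $\|\mathcal{F}_k-T\|_\infty=\min\{\|v-T\|_\infty: v\in G_k\}$. Let $M=\max\{T_1,\ldots,T_n\}$ and $m=\min\{T_1,\ldots,T_n\}$. "$T$ has a maximum between two minima" means there are indices $i<j<l$ with $T_i=T_l=m$ and $T_j=M$; "$T$ has a minimum between two maxima" means there are indices $i<j<l$ with $T_i=T_l=M$ and $T_j=m$. A function $f:(-\infty,0)\to\mathbb{R}$ is quasiconvex if $f(\lambda x+(1-\lambda)y)\le\max\{f(x),f(y)\}$ for all $x,y\in(-\infty,0)$ and $\lambda\in(0,1)$; it is strictly quasiconvex if this inequality is strict for all $x\neq y$ and $\lambda\in(0,1)$. *)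

theory Defs
  imports "HOL-Analysis.Analysis"
begin

text \<open>Vectors in \<open>\<real>\<^sup>n\<close> are indexed by an arbitrary finite linearly ordered type \<open>'n\<close> with
  \<open>n = CARD('n)\<close>; the library's \<^const>\<open>infnorm\<close> is the norm \<open>\<parallel>\<cdot>\<parallel>\<^sub>\<infinity>\<close>.\<close>

definition exp_space :: "real ^ 'n \<Rightarrow> real \<Rightarrow> (real ^ 'n) set" where
  "exp_space t k = span {\<chi> i. exp (k * t $ i), \<chi> i. 1}"

text \<open>The description is proper, i.e. there is exactly one minimiser, whenever \<open>k < 0\<close>, the
  components of \<open>t\<close> are pairwise distinct and \<open>CARD('n) \<ge> 2\<close>.\<close>

definition best_approx :: "real ^ 'n \<Rightarrow> real ^ 'n \<Rightarrow> real \<Rightarrow> real ^ 'n" where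
  "best_approx t T k = (THE v. is_arg_min (\<lambda>v. infnorm (v - T)) (\<lambda>v. v \<in> exp_space t k) v)"

definition approx_error :: "real ^ 'n \<Rightarrow> real ^ 'n \<Rightarrow> real \<Rightarrow> real" where
  "approx_error t T k = infnorm (best_approx t T k - T)"

definition has_max_between_minima :: "real ^ ('n::{finite,linorder}) \<Rightarrow> bool" where
  "has_max_between_minima T \<longleftrightarrow>
     (\<exists>i j l. i < j \<and> j < l \<and>
        T $ i = Min (range (($) T)) \<and> T $ l = Min (range (($) T)) \<and> T $ j = Max (range (($) T)))"

definition has_min_between_maxima :: "real ^ ('n::{finite,linorder}) \<Rightarrow> bool" where
  "has_min_between_maxima T \<longleftrightarrow>
     (\<exists>i j l. i < j \<and> j < l \<and>
        T $ i = Max (range (($) T)) \<and> T $ l = Max (range (($) T)) \<and> T $ j = Min (range (($) T)))"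

definition quasiconvex_on :: "real set \<Rightarrow> (real \<Rightarrow> real) \<Rightarrow> bool" where
  "quasiconvex_on S f \<longleftrightarrow>
     (\<forall>x\<in>S. \<forall>y\<in>S. \<forall>c\<in>{0<..<1}. f (c * x + (1 - c) * y) \<le> max (f x) (f y))"

definition strictly_quasiconvex_on :: "real set \<Rightarrow> (real \<Rightarrow> real) \<Rightarrow> bool" where
  "strictly_quasiconvex_on S f \<longleftrightarrow>
     (\<forall>x\<in>S. \<forall>y\<in>S. \<forall>c\<in>{0<..<1}. x \<noteq> y \<longrightarrow> f (c * x + (1 - c) * y) < max (f x) (f y))"

end

theory Submission
  imports Defs
begin

text \<open>On a triple of indices the space \<open>span {e, 1}\<close> is annihilated by a functional with signs
  \<open>-, +, -\<close>, which bounds the approximation error from below. Helly's theorem in the plane of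
  coefficients shows that the error is the maximum of these triple bounds. Each of them is the
  absolute value of an affine function of a weight that is strictly monotone in \<open>k\<close>, and is
  therefore quasiconvex, strictly unless the outer two values of \<open>T\<close> agree. In the latter case a
  value of \<open>T\<close> outside the range of the triple gives a triple with a larger error.\<close>

section \<open>Approximation from the span of a strictly decreasing vector and the constants\<close>

text \<open>For \<open>e $ i \<noteq> e $ l\<close> this is the \<open>w\<close> with
  \<open>e $ j = (1 - w) * e $ i + w * e $ l\<close>, so the coefficients \<open>-(1 - w)\<close>,
  \<open>1\<close>, \<open>-w\<close> at \<open>i\<close>, \<open>j\<close>, \<open>l\<close>
  annihilate both \<open>e\<close> and the constants.\<close>

definition weight :: "real ^ 'n \<Rightarrow> 'n \<Rightarrow> 'n \<Rightarrow> 'n \<Rightarrow> real" where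
  "weight e i j l = (e $ i - e $ j) / (e $ i - e $ l)"

text \<open>The absolute values of these coefficients sum to 2 when the weight lies in the unit
  interval; hence the division by 2.\<close>

definition triple_error :: "real ^ 'n \<Rightarrow> real ^ 'n \<Rightarrow> 'n \<Rightarrow> 'n \<Rightarrow> 'n \<Rightarrow> real" where
  "triple_error e T i j l =
     \<bar>T $ j - (1 - weight e i j l) * T $ i - weight e i j l * T $ l\<bar> / 2"

section \<open>Lower bounds from triples\<close>

lemma infnorm_le_cart: "infnorm (x :: real ^ 'n) \<le> d \<longleftrightarrow> (\<forall>i. \<bar>x $ i\<bar> \<le> d)"
  by (auto simp: infnorm_Max Basis_vec_def inner_axis)

lemma span_ones: "v \<in> span {e, \<chi> i. 1} \<longleftrightarrow> (\<exists>a b. v = (\<chi> i. a * e $ i + b))"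
  for v e :: "real ^ 'n"
  by (auto simp: span_breakdown_eq vec_eq_iff algebra_simps)

lemma weight_bounds:
  assumes "e $ j < e $ i" "e $ l < e $ j"
  shows "0 < weight e i j l" "weight e i j l < 1"
  using assms by (auto simp: weight_def)

lemma weight_annihilates:
  assumes "e $ i \<noteq> e $ l" "v \<in> span {e, \<chi> i. 1}"
  shows "v $ j = (1 - weight e i j l) * v $ i + weight e i j l * v $ l"
proof -
  obtain a b where v: "v = (\<chi> i. a * e $ i + b)"
    using assms(2) by (auto simp: span_ones)
  have "weight e i j l * (e $ i - e $ l) = e $ i - e $ j"
    using assms(1) by (simp add: weight_def)
  then have "a * (weight e i j l * (e $ i - e $ l)) = a * (e $ i - e $ j)"
    by simp
  then show ?thesis
    by (simp add: v algebra_simps)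
qed

text \<open>Duality: the functional has the same absolute value on \<open>T\<close> as on the
  residual \<open>v - T\<close>, and its coefficients have absolute sum 2.\<close>

lemma triple_error_le:
  assumes "e $ j < e $ i" "e $ l < e $ j" "v \<in> span {e, \<chi> i. 1}"
  shows "triple_error e T i j l \<le> infnorm (v - T)"
proof -
  define w where "w = weight e i j l"
  define d where "d = infnorm (v - T)"
  have w: "0 < w" "w < 1"
    using weight_bounds[of e j i l] assms by (auto simp: w_def)
  have v: "v $ j = (1 - w) * v $ i + w * v $ l"
    using weight_annihilates[of e i l v j] assms by (auto simp: w_def)
  have r: "\<bar>v $ p - T $ p\<bar> \<le> d" for p
    using component_le_infnorm_cart[of "v - T" p] by (simp add: d_def)
  have "T $ j - (1 - w) * T $ i - w * T $ l
      = (1 - w) * (v $ i - T $ i) + w * (v $ l - T $ l) - (v $ j - T $ j)"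
    unfolding v by (simp add: algebra_simps)
  also have "\<bar>\<dots>\<bar> \<le> (1 - w) * \<bar>v $ i - T $ i\<bar> + w * \<bar>v $ l - T $ l\<bar> + \<bar>v $ j - T $ j\<bar>"
    using w abs_triangle_ineq4[of "(1 - w) * (v $ i - T $ i) + w * (v $ l - T $ l)" "v $ j - T $ j"]
      abs_triangle_ineq[of "(1 - w) * (v $ i - T $ i)" "w * (v $ l - T $ l)"]
    by (simp add: abs_mult)
  also have "\<dots> \<le> (1 - w) * d + w * d + d"
    using w r by (intro add_mono mult_left_mono) auto
  finally show ?thesis
    by (simp add: triple_error_def w_def d_def algebra_simps)
qed

text \<open>Equality in the lower bound forces the residual to alternate on the triple.\<close>

lemma triple_error_eqD:
  assumes "e $ j < e $ i" "e $ l < e $ j" "v \<in> span {e, \<chi> i. 1}"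
    and eq: "infnorm (v - T) = triple_error e T i j l"
  defines "s \<equiv> (T $ j - (1 - weight e i j l) * T $ i - weight e i j l * T $ l) / 2"
  shows "v $ j = T $ j - s" "v $ i = T $ i + s"
proof -
  define w where "w = weight e i j l"
  define R where "R p = v $ p - T $ p" for p
  have w: "0 < w" "w < 1"
    using weight_bounds[of e j i l] assms by (auto simp: w_def)
  have v: "v $ j = (1 - w) * v $ i + w * v $ l"
    using weight_annihilates[of e i l v j] assms by (auto simp: w_def)
  have s: "2 * s = (1 - w) * R i + w * R l - R j"
    unfolding s_def w_def[symmetric] R_def v by (simp add: field_simps)
  have "\<bar>R p\<bar> \<le> \<bar>s\<bar>" for p
    using component_le_infnorm_cart[of "v - T" p] eq
    by (simp add: R_def triple_error_def s_def)
  then have r: "R p \<le> \<bar>s\<bar>" "- \<bar>s\<bar> \<le> R p" for p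
    by (simp_all add: abs_le_iff minus_le_iff)
  \<comment> \<open>These bounds and \<open>r\<close> keep the right side of \<open>s\<close> within
    \<open>2 * \<bar>s\<bar>\<close>. That value is attained, so the bounds of matching sign are
    equalities.\<close>
  have m: "(1 - w) * R i \<le> (1 - w) * \<bar>s\<bar>" "w * R l \<le> w * \<bar>s\<bar>"
     "(1 - w) * (- \<bar>s\<bar>) \<le> (1 - w) * R i" "w * (- \<bar>s\<bar>) \<le> w * R l"
    using w r by (intro mult_left_mono; simp)+
  have "R j = - s \<and> (1 - w) * R i = (1 - w) * s"
    using s m r[of j] by (cases "s \<ge> 0") (simp_all add: algebra_simps)
  then show "v $ j = T $ j - s" "v $ i = T $ i + s"
    using w by (auto simp: R_def)
qed

text \<open>Used for uniqueness: two values fix the slope \<open>a\<close>, then the offset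
  \<open>b\<close>.\<close>

lemma span_ones_eqI:
  fixes e :: "real ^ 'n"
  assumes "v \<in> span {e, \<chi> i. 1}" "v' \<in> span {e, \<chi> i. 1}" "e $ i \<noteq> e $ j"
    and "v $ i = v' $ i" "v $ j = v' $ j"
  shows "v = v'"
proof -
  obtain a b a' b' where v: "v = (\<chi> i. a * e $ i + b)" "v' = (\<chi> i. a' * e $ i + b')"
    using assms(1,2) by (auto simp: span_ones)
  have "(a - a') * (e $ i - e $ j) = 0"
    using assms(4,5) by (simp add: v algebra_simps)
  then have "a = a'"
    using assms(3) by simp
  then show ?thesis
    using assms(4) v by simp
qed

section \<open>Sharpness of the lower bounds and the best approximation\<close>

lemma triple_interpolation:
  assumes "e $ j < e $ i" "e $ l < e $ j" "triple_error e T i j l \<le> d"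
  shows "\<exists>a b. \<forall>p\<in>{i, j, l}. \<bar>a * e $ p + b - T $ p\<bar> \<le> d"
proof -
  define w where "w = weight e i j l"
  \<comment> \<open>The line through the two outer points, shifted by \<open>s\<close>, has
    residuals \<open>s\<close>, \<open>-s\<close>, \<open>s\<close> on the triple.\<close>
  define s where "s = (T $ j - (1 - w) * T $ i - w * T $ l) / 2"
  define a where "a = (T $ i - T $ l) / (e $ i - e $ l)"
  define b where "b = T $ i + s - a * e $ i"
  have d: "\<bar>s\<bar> \<le> d"
    using assms(3) by (simp add: triple_error_def s_def w_def)
  have 1: "a * (e $ i - e $ l) = T $ i - T $ l"
    using assms by (simp add: a_def)
  have 2: "a * (e $ i - e $ j) = w * (T $ i - T $ l)"
    by (simp add: a_def w_def weight_def)
  have "a * e $ i + b - T $ i = s"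
    by (simp add: b_def)
  moreover have "a * e $ l + b - T $ l = s"
    using 1 by (simp add: b_def algebra_simps)
  moreover have "a * e $ j + b - T $ j = - s"
    using 2 by (simp add: b_def s_def field_simps)
  ultimately show ?thesis
    using d by (intro exI[of _ a] exI[of _ b]) auto
qed

lemma card_3_ordered:
  fixes S :: "'n::linorder set"
  assumes "card S = 3"
  obtains i j l where "S = {i, j, l}" "i < j" "j < l"
proof -
  obtain x y z where S: "S = {x, y, z}" "x \<noteq> y" "y \<noteq> z" "x \<noteq> z"
    using assms by (auto simp: card_3_iff)
  then show ?thesis
    using that[of x y z] that[of x z y] that[of y x z] that[of y z x] that[of z x y] that[of z y x]
    by (auto simp: insert_commute neq_iff)
qed

text \<open>Each index \<open>p\<close> confines the coefficients \<open>(a, b)\<close> to a strip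
  \<open>C p\<close> in the plane. Interpolation on triples makes any three strips meet, and by
  Helly's theorem all of them meet.\<close>

lemma exists_approximation:
  fixes e T :: "real ^ ('n::{finite,linorder})"
  assumes card: "CARD('n) \<ge> 3"
    and decr: "\<And>i j. i < j \<Longrightarrow> e $ j < e $ i"
    and le: "\<And>i j l. i < j \<Longrightarrow> j < l \<Longrightarrow> triple_error e T i j l \<le> d"
  shows "\<exists>v\<in>span {e, \<chi> i. 1}. infnorm (v - T) \<le> d"
proof -
  define C where "C p = {x :: real \<times> real. \<bar>fst x * e $ p + snd x - T $ p\<bar> \<le> d}" for p
  have few: "\<Inter> (C ` S) \<noteq> {}" if "card S \<le> 3" for S
  proof -
    \<comment> \<open>Smaller index sets are padded to triples.\<close>
    obtain S' where "S \<subseteq> S'" "card S' = 3"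
      using exists_subset_between[of S 3 UNIV] \<open>card S \<le> 3\<close> card by auto
    moreover obtain i j l where ijl: "S' = {i, j, l}" "i < j" "j < l"
      using card_3_ordered \<open>card S' = 3\<close> by metis
    ultimately obtain a b where "\<forall>p\<in>S. \<bar>a * e $ p + b - T $ p\<bar> \<le> d"
      using triple_interpolation[OF decr decr le, OF ijl(2,3,2,3)] by blast
    then have "(a, b) \<in> \<Inter> (C ` S)"
      by (auto simp: C_def)
    then show ?thesis
      by blast
  qed
  have convex: "convex (C p)" for p
  proof -
    have "C p = (\<lambda>x. fst x * e $ p + snd x) -` {T $ p - d..T $ p + d}"
      by (auto simp: C_def abs_le_iff)
    moreover have "linear (\<lambda>x :: real \<times> real. fst x * e $ p + snd x)"
      by (intro linearI) (auto simp: algebra_simps)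
    ultimately show ?thesis
      by (simp add: convex_linear_vimage)
  qed
  \<comment> \<open>Helly's theorem counts distinct strips, so one index is chosen per
    strip.\<close>
  have few': "\<Inter> F \<noteq> {}" if "F \<subseteq> range C" "card F \<le> 3" for F
    using that few by (auto simp: subset_image_inj card_image)
  have "\<Inter> (range C) \<noteq> {}"
  \<comment> \<open>Helly's theorem asks for a family of at least three sets; small families are
    settled directly.\<close>
  proof (cases "card (range C) \<le> 3")
    case True
    then show ?thesis
      by (rule few'[OF order.refl])
  next
    case False
    show ?thesis
    proof (rule Helly)
      show "DIM(real \<times> real) + 1 \<le> card (range C)"
        using False by simp
      show "\<forall>S\<in>range C. convex S"
        using convex by blast
      show "\<Inter> F \<noteq> {}" if "F \<subseteq> range C" "card F = DIM(real \<times> real) + 1" for F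
        using that by (intro few') simp_all
    qed
  qed
  then obtain x where "\<And>p. x \<in> C p"
    by blast
  then show ?thesis
    by (intro bexI[of _ "\<chi> p. fst x * e $ p + snd x"])
      (auto simp: C_def infnorm_le_cart span_ones)
qed

text \<open>The largest triple error bounds every element of the span from below and is reached by
  some element, so every minimiser attains it. Equality on one fixed maximal triple prescribes the
  values at \<open>i\<close> and \<open>j\<close>, which gives uniqueness.\<close>

lemma best_approximation:
  fixes e T :: "real ^ ('n::{finite,linorder})"
  assumes card: "CARD('n) \<ge> 3"
    and decr: "\<And>i j. i < j \<Longrightarrow> e $ j < e $ i"
  defines "f \<equiv> \<lambda>v. infnorm (v - T)"
  shows "\<exists>!v. is_arg_min f (\<lambda>v. v \<in> span {e, \<chi> i. 1}) v"
    and "is_arg_min f (\<lambda>v. v \<in> span {e, \<chi> i. 1}) v \<Longrightarrow>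
      \<exists>i j l. i < j \<and> j < l \<and> f v = triple_error e T i j l"
proof -
  define D where "D = {(i, j, l). i < j \<and> j < (l::'n)}"
  define g where "g = (\<lambda>(i, j, l). triple_error e T i j l)"
  obtain S :: "'n set" where "card S = 3"
    using obtain_subset_with_card_n[OF card] by metis
  then obtain i j l :: 'n where "i < j" "j < l"
    using card_3_ordered by metis
  then have "D \<noteq> {}"
    by (auto simp: D_def)
  then have "Max (g ` D) \<in> g ` D"
    by (intro Max_in) auto
  then obtain i j l where ijl: "i < j" "j < l" and "Max (g ` D) = triple_error e T i j l"
    by (auto simp: D_def g_def)
  moreover have "g (i, j, l) \<le> Max (g ` D)" if "i < j" "j < l" for i j l
    using that by (intro Max_ge) (auto simp: D_def)
  ultimately have max: "triple_error e T i' j' l' \<le> triple_error e T i j l"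
    if "i' < j'" "j' < l'" for i' j' l'
    using that by (auto simp: g_def)
  note e = decr[OF ijl(1)] decr[OF ijl(2)]
  obtain v where v: "v \<in> span {e, \<chi> i. 1}" "f v \<le> triple_error e T i j l"
    using exists_approximation[OF card decr max] by (auto simp: f_def)
  have low: "triple_error e T i j l \<le> f u" if "u \<in> span {e, \<chi> i. 1}" for u
    using triple_error_le[OF e that] by (simp add: f_def)
  have eq: "f u = triple_error e T i j l" "u \<in> span {e, \<chi> i. 1}"
    if "is_arg_min f (\<lambda>v. v \<in> span {e, \<chi> i. 1}) u" for u
    using that v low[of u] by (auto simp: is_arg_min_linorder intro: order.trans antisym)
  show "\<exists>!v. is_arg_min f (\<lambda>v. v \<in> span {e, \<chi> i. 1}) v"
  proof (rule ex_ex1I)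
    show "\<exists>v. is_arg_min f (\<lambda>v. v \<in> span {e, \<chi> i. 1}) v"
      using v low by (auto simp: is_arg_min_linorder intro: order.trans)
    fix u u'
    assume "is_arg_min f (\<lambda>v. v \<in> span {e, \<chi> i. 1}) u"
      and "is_arg_min f (\<lambda>v. v \<in> span {e, \<chi> i. 1}) u'"
    note u = eq[OF this(1)] eq[OF this(2)]
    show "u = u'"
      using u triple_error_eqD[OF e, of u T] triple_error_eqD[OF e, of u' T] e
      by (intro span_ones_eqI[of u e u' i j]) (auto simp: f_def)
  qed
  show "\<exists>i j l. i < j \<and> j < l \<and> f v = triple_error e T i j l"
    if "is_arg_min f (\<lambda>v. v \<in> span {e, \<chi> i. 1}) v" for v
    using eq[OF that] ijl by blast
qed

section \<open>Dependence of the error on the exponent\<close>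

definition exp_vec :: "real ^ 'n \<Rightarrow> real \<Rightarrow> real ^ 'n" where
  "exp_vec t k = (\<chi> i. exp (k * t $ i))"

lemma exp_vec_decreasing:
  assumes "strict_mono (\<lambda>i. t $ i)" "k < 0" "i < j"
  shows "exp_vec t k $ j < exp_vec t k $ i"
  using strict_monoD[OF assms(1,3)] assms(2) by (simp add: exp_vec_def)

text \<open>Uniqueness gives the definite description in \<open>best_approx\<close> its meaning.
  From here on the error enters only as the maximum of the triple errors.\<close>

lemma approx_error_eq_triple_error:
  fixes t T :: "real ^ ('n::{finite,linorder})"
  assumes "CARD('n) \<ge> 3" "strict_mono (\<lambda>i. t $ i)" "k < 0"
  shows "\<exists>i j l. i < j \<and> j < l \<and> approx_error t T k = triple_error (exp_vec t k) T i j l"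
    and "\<And>i j l. i < j \<Longrightarrow> j < l \<Longrightarrow> triple_error (exp_vec t k) T i j l \<le> approx_error t T k"
proof -
  note decr = exp_vec_decreasing[OF assms(2,3)]
  have space: "exp_space t k = span {exp_vec t k, \<chi> i. 1}"
    by (simp add: exp_space_def exp_vec_def)
  have best: "is_arg_min (\<lambda>v. infnorm (v - T)) (\<lambda>v. v \<in> span {exp_vec t k, \<chi> i. 1})
      (best_approx t T k)"
    unfolding best_approx_def space by (rule theI') (rule best_approximation(1)[OF assms(1) decr])
  show "\<exists>i j l. i < j \<and> j < l \<and> approx_error t T k = triple_error (exp_vec t k) T i j l"
    unfolding approx_error_def by (rule best_approximation(2)[OF assms(1) decr best])
  show "triple_error (exp_vec t k) T i j l \<le> approx_error t T k" if "i < j" "j < l" for i j l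
    unfolding approx_error_def using best
    by (intro triple_error_le decr that) (auto simp: is_arg_min_def)
qed

section \<open>Monotonicity of the weight and quasiconvexity of triple errors\<close>

text \<open>The quotients are slopes of chords of the strictly concave function
  \<open>z powr r\<close> ending at 1. The mean value theorem on \<open>[x, y]\<close> and
  \<open>[y, 1]\<close> yields slopes \<open>s1 > s2\<close>.\<close>

lemma powr_chord_slope_decreasing:
  fixes r x y :: real
  assumes "0 < r" "r < 1" "0 < x" "x < y" "y < 1"
  shows "(1 - y powr r) / (1 - y) < (1 - x powr r) / (1 - x)"
proof -
  have d: "((\<lambda>x. x powr r) has_real_derivative r * z powr (r - 1)) (at z)" if "0 < z" for z
    using that by (auto intro!: derivative_eq_intros)
  obtain z1 where z1: "x < z1" "z1 < y" "y powr r - x powr r = (y - x) * (r * z1 powr (r - 1))"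
    using MVT2[OF assms(4), of "\<lambda>x. x powr r" "\<lambda>z. r * z powr (r - 1)"] d assms by auto
  obtain z2 where z2: "y < z2" "1 powr r - y powr r = (1 - y) * (r * z2 powr (r - 1))"
    using MVT2[OF assms(5), of "\<lambda>x. x powr r" "\<lambda>z. r * z powr (r - 1)"] d assms by auto
  define s1 s2 where "s1 = r * z1 powr (r - 1)" and "s2 = r * z2 powr (r - 1)"
  have "s2 < s1"
    unfolding s1_def s2_def using assms z1 z2 by (intro mult_strict_left_mono powr_less_mono2_neg) auto
  have Y: "1 - y powr r = (1 - y) * s2"
    using z2 by (simp add: s2_def)
  have X: "1 - x powr r = (1 - y) * s2 + (y - x) * s1"
    using z1 Y by (simp add: s1_def)
  \<comment> \<open>The slope of the chord from \<open>x\<close> to 1 is a weighted mean of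
    \<open>s1\<close> and \<open>s2\<close>, hence exceeds \<open>s2\<close>.\<close>
  have "(1 - x) * s2 < (1 - y) * s2 + (y - x) * s1"
    using mult_strict_left_mono[OF \<open>s2 < s1\<close>, of "y - x"] assms by (simp add: algebra_simps)
  then show ?thesis
    using assms unfolding X Y by (simp add: pos_less_divide_eq mult.commute)
qed

text \<open>Cancelling \<open>exp (k * t $ i)\<close> turns the weight into the chord slope above at
  the point \<open>exp (k * q)\<close>, which increases with \<open>k\<close> and stays below 1 for
  \<open>k < 0\<close>.\<close>

lemma weight_exp_vec_antimono:
  assumes "t $ i < t $ j" "t $ j < t $ l" "k < k'" "k' < 0"
  shows "weight (exp_vec t k') i j l < weight (exp_vec t k) i j l"
proof -
  define q where "q = t $ l - t $ i"
  define r where "r = (t $ j - t $ i) / q"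
  have q: "0 < q" and r: "0 < r" "r < 1"
    using assms by (auto simp: q_def r_def)
  have W: "weight (exp_vec t a) i j l = (1 - exp (a * q) powr r) / (1 - exp (a * q))" for a
  proof -
    have "exp (a * q) powr r = exp (a * (t $ j - t $ i))"
      using q by (simp add: powr_def r_def)
    moreover have "exp (a * t $ i) * (1 - exp (a * (t $ j - t $ i))) = exp (a * t $ i) - exp (a * t $ j)"
      by (simp add: algebra_simps flip: exp_add)
    moreover have "exp (a * t $ i) * (1 - exp (a * q)) = exp (a * t $ i) - exp (a * t $ l)"
      by (simp add: q_def algebra_simps flip: exp_add)
    ultimately show ?thesis
      by (simp add: weight_def exp_vec_def)
        (metis exp_not_eq_zero mult_divide_mult_cancel_left)
  qed
  show ?thesis
    unfolding W using assms q r by (intro powr_chord_slope_decreasing) (auto simp: mult_neg_pos)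
qed

text \<open>For \<open>b \<noteq> 0\<close> the affine value at \<open>w\<close> lies strictly
  between those at \<open>u\<close> and \<open>v\<close>, so its modulus is below the larger of
  theirs.\<close>

lemma abs_affine_between:
  fixes a b u w v :: real
  assumes "u < w" "w < v"
  shows "\<bar>a - b * w\<bar> \<le> max \<bar>a - b * u\<bar> \<bar>a - b * v\<bar>"
    and "b \<noteq> 0 \<Longrightarrow> \<bar>a - b * w\<bar> < max \<bar>a - b * u\<bar> \<bar>a - b * v\<bar>"
proof -
  consider "b = 0" | "b * u < b * w" "b * w < b * v" | "b * w < b * u" "b * v < b * w"
    using assms by (cases b "0 :: real" rule: linorder_cases) auto
  then have "\<bar>a - b * w\<bar> \<le> max \<bar>a - b * u\<bar> \<bar>a - b * v\<bar> \<and>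
    (b \<noteq> 0 \<longrightarrow> \<bar>a - b * w\<bar> < max \<bar>a - b * u\<bar> \<bar>a - b * v\<bar>)"
    by cases (simp, linarith, linarith)
  then show "\<bar>a - b * w\<bar> \<le> max \<bar>a - b * u\<bar> \<bar>a - b * v\<bar>"
    "b \<noteq> 0 \<Longrightarrow> \<bar>a - b * w\<bar> < max \<bar>a - b * u\<bar> \<bar>a - b * v\<bar>"
    by auto
qed

text \<open>The exponent enters only through the weight, and the expression inside the modulus is
  affine in it with slope \<open>T $ i - T $ l\<close>.\<close>

lemma triple_error_quasiconvex:
  fixes t T :: "real ^ 'n"
  assumes "t $ i < t $ j" "t $ j < t $ l" "k1 < k" "k < k2" "k2 < 0"
  defines "f \<equiv> \<lambda>k. triple_error (exp_vec t k) T i j l"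
  shows "f k \<le> max (f k1) (f k2)"
    and "T $ i \<noteq> T $ l \<Longrightarrow> f k < max (f k1) (f k2)"
proof -
  define w where "w k = weight (exp_vec t k) i j l" for k
  have w: "w k2 < w k" "w k < w k1"
    using weight_exp_vec_antimono[of t i j l] assms by (auto simp: w_def)
  have f: "f k = \<bar>(T $ j - T $ i) - (T $ l - T $ i) * w k\<bar> / 2" for k
    by (simp add: f_def triple_error_def w_def algebra_simps)
  note * = abs_affine_between[OF w, where a = "T $ j - T $ i" and b = "T $ l - T $ i"]
  show "f k \<le> max (f k1) (f k2)"
    using *(1) unfolding f max_def by (auto split: if_splits)
  show "f k < max (f k1) (f k2)" if "T $ i \<noteq> T $ l"
    using *(2) that unfolding f max_def by (auto split: if_splits)
qed

section \<open>Triples with equal outer values\<close>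

lemma triple_error_uminus: "triple_error e (- T) i j l = triple_error e T i j l"
  by (simp add: triple_error_def abs_minus_commute algebra_simps)

text \<open>With equal outer values the weight drops out, and the error is half the height of the
  middle value above them. A value at \<open>p\<close> beyond this range enlarges the gap in a
  triple chosen by the position of \<open>p\<close>.\<close>

lemma larger_triple_error:
  fixes e T :: "real ^ ('n::{finite,linorder})"
  assumes decr: "\<And>i j. i < j \<Longrightarrow> e $ j < e $ i"
    and ijl: "i < j" "j < l" "T $ i = T $ l" "T $ i \<le> T $ j"
    and p: "T $ p < T $ i \<or> T $ j < T $ p"
  shows "\<exists>i' j' l'. i' < j' \<and> j' < l' \<and> triple_error e T i j l < triple_error e T i' j' l'"
proof -
  define c where "c = T $ i"
  have w: "0 < weight e a b d" "weight e a b d < 1" if "a < b" "b < d" for a b d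
    using weight_bounds decr that by blast+
  have E: "triple_error e T i j l = (T $ j - c) / 2"
    using ijl(3,4) by (simp add: triple_error_def c_def algebra_simps)
  have outer: "(1 - x) * c + x * y < c" "(1 - x) * y + x * c < c"
    if "y < c" "0 < x" "x < 1" for x y
    using mult_strict_left_mono[OF that(1), of x] mult_strict_left_mono[OF that(1), of "1 - x"] that
    by (simp_all add: algebra_simps)
  have inner: "T $ j < (1 - x) * T $ p + x * T $ j" "T $ j < (1 - x) * T $ j + x * T $ p"
    if "T $ j < T $ p" "0 < x" "x < 1" for x
    using mult_strict_left_mono[OF that(1), of x] mult_strict_left_mono[OF that(1), of "1 - x"] that
    by (simp_all add: algebra_simps)
  show ?thesis
    using p
  proof
    assume lt: "T $ p < T $ i"
    \<comment> \<open>The low value at \<open>p\<close> replaces an outer one: that at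
      \<open>i\<close> if \<open>p < j\<close>, otherwise that at \<open>l\<close>.\<close>
    then consider "p < j" | "j < p"
      using ijl(4) by (metis neq_iff not_le)
    then show ?thesis
    proof cases
      case 1
      have "triple_error e T i j l < triple_error e T p j l"
        using outer(2)[OF _ w[OF 1 ijl(2)], of "T $ p"] lt ijl
        by (simp add: E) (simp add: triple_error_def c_def)
      then show ?thesis using 1 ijl by blast
    next
      case 2
      have "triple_error e T i j l < triple_error e T i j p"
        using outer(1)[OF _ w[OF ijl(1) 2], of "T $ p"] lt ijl
        by (simp add: E) (simp add: triple_error_def c_def)
      then show ?thesis using 2 ijl by blast
    qed
  next
    assume gt: "T $ j < T $ p"
    \<comment> \<open>A high \<open>p\<close> between \<open>i\<close> and \<open>l\<close> becomes
      the middle. Outside, the nearer end becomes a low middle between the high values at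
      \<open>p\<close> and \<open>j\<close>.\<close>
    then consider "p < i" | "i < p" "p < l" | "l < p"
      using ijl(3,4) by (metis neq_iff not_le)
    then show ?thesis
    proof cases
      case 1
      have "triple_error e T i j l < triple_error e T p i j"
        using inner(1)[OF gt w[OF 1 ijl(1)]] ijl
        by (simp add: E) (simp add: triple_error_def c_def)
      then show ?thesis using 1 ijl by blast
    next
      case 2
      have "triple_error e T i j l < triple_error e T i p l"
        unfolding E using gt ijl(3,4) by (simp add: triple_error_def c_def field_simps)
      then show ?thesis using 2 by blast
    next
      case 3
      have "triple_error e T i j l < triple_error e T j l p"
        using inner(2)[OF gt w[OF ijl(2) 3]] ijl
        by (simp add: E) (simp add: triple_error_def c_def)
      then show ?thesis using 3 ijl by blast
    qed
  qed
qed

text \<open>If the outer values agreed, maximality would confine all of \<open>T\<close> between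
  \<open>T $ i\<close> and \<open>T $ j\<close>, making the triple one of the excluded
  patterns.\<close>

lemma maximal_triple_outer_neq:
  fixes e T :: "real ^ ('n::{finite,linorder})"
  assumes decr: "\<And>i j. i < j \<Longrightarrow> e $ j < e $ i"
    and ijl: "i < j" "j < l"
    and max: "\<And>i' j' l'. i' < j' \<Longrightarrow> j' < l' \<Longrightarrow> triple_error e T i' j' l' \<le> triple_error e T i j l"
    and T: "\<not> has_max_between_minima T" "\<not> has_min_between_maxima T"
  shows "T $ i \<noteq> T $ l"
proof
  assume eq: "T $ i = T $ l"
  have Min: "Min (range (($) T)) = x" if "x \<in> range (($) T)" "\<And>p. x \<le> T $ p" for x
    using that by (intro Min_eqI) auto
  have Max: "Max (range (($) T)) = x" if "x \<in> range (($) T)" "\<And>p. T $ p \<le> x" for x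
    using that by (intro Max_eqI) auto
  show False
  proof (cases "T $ i \<le> T $ j")
    case True
    obtain p where "T $ p < T $ i \<or> T $ j < T $ p"
      using T(1) ijl eq Min[of "T $ i"] Max[of "T $ j"]
      unfolding has_max_between_minima_def by (metis not_le rangeI)
    then show False
      using larger_triple_error[OF decr ijl eq True] max by (metis not_le)
  next
    case False
    obtain p where "T $ p < T $ j \<or> T $ i < T $ p"
      using T(2) ijl eq Min[of "T $ j"] Max[of "T $ i"]
      unfolding has_min_between_maxima_def by (metis not_le rangeI)
    \<comment> \<open>Negating \<open>T\<close> keeps all triple errors and turns the low middle
      value into a high one.\<close>
    then show False
      using larger_triple_error[OF decr ijl, of "- T" p] eq False max
      unfolding triple_error_uminus by (simp add: leD disj_commute) (metis leD)
  qed
qed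

section \<open>Quasiconvexity of the error function\<close>

theorem theorem2p17:
  fixes t T :: "real ^ ('n::{finite,linorder})"
  assumes "CARD('n) \<ge> 3"
    and "strict_mono (\<lambda>i. t $ i)"
  shows "quasiconvex_on {..<0} (approx_error t T) \<and>
    (\<not> has_max_between_minima T \<and> \<not> has_min_between_maxima T \<longrightarrow>
       strictly_quasiconvex_on {..<0} (approx_error t T))"
proof -
  define E where "E = approx_error t T"
  note t = strict_monoD[OF assms(2)]
  note attained = approx_error_eq_triple_error(1)[OF assms, where T = T, folded E_def]
  note bound = approx_error_eq_triple_error(2)[OF assms, where T = T, folded E_def]
  \<comment> \<open>A triple attaining the error at the middle exponent still bounds the error from
    below at the other two.\<close>
  have quasi: "E k \<le> max (E k1) (E k2)" if k: "k1 < k" "k < k2" "k2 < 0" for k k1 k2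
  proof -
    obtain i j l where ijl: "i < j" "j < l" and "E k = triple_error (exp_vec t k) T i j l"
      using attained[of k] k by auto
    then have "E k \<le> max (triple_error (exp_vec t k1) T i j l) (triple_error (exp_vec t k2) T i j l)"
      using triple_error_quasiconvex(1)[OF t t k] by metis
    also have "\<dots> \<le> max (E k1) (E k2)"
      using k by (intro max.mono bound ijl) auto
    finally show ?thesis .
  qed
  have strict: "E k < max (E k1) (E k2)" if k: "k1 < k" "k < k2" "k2 < 0"
    and T: "\<not> has_max_between_minima T" "\<not> has_min_between_maxima T" for k k1 k2
  proof -
    obtain i j l where ijl: "i < j" "j < l" and eq: "E k = triple_error (exp_vec t k) T i j l"
      using attained[of k] k by auto
    \<comment> \<open>The chosen triple has the largest error at \<open>k\<close>, so its outer
      values differ.\<close>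
    have "T $ i \<noteq> T $ l"
    proof (rule maximal_triple_outer_neq[OF _ ijl _ T])
      show "exp_vec t k $ b < exp_vec t k $ a" if "a < b" for a b
        using exp_vec_decreasing[OF assms(2) _ that] k by simp
      show "triple_error (exp_vec t k) T i' j' l' \<le> triple_error (exp_vec t k) T i j l"
        if "i' < j'" "j' < l'" for i' j' l'
        using bound[OF _ that, of k] k eq by simp
    qed
    then have "E k < max (triple_error (exp_vec t k1) T i j l) (triple_error (exp_vec t k2) T i j l)"
      using triple_error_quasiconvex(2)[OF t t k] ijl eq by metis
    also have "\<dots> \<le> max (E k1) (E k2)"
      using k by (intro max.mono bound ijl) auto
    finally show ?thesis .
  qed
  have between: "min x y < c * x + (1 - c) * y" "c * x + (1 - c) * y < max x y"
    if "x \<noteq> y" "0 < c" "c < 1" for x y c :: real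
  proof -
    have "c * min x y + (1 - c) * min x y < c * x + (1 - c) * y"
      "c * x + (1 - c) * y < c * max x y + (1 - c) * max x y"
      using that by (cases "x < y"; simp)+
    then show "min x y < c * x + (1 - c) * y" "c * x + (1 - c) * y < max x y"
      by (simp_all add: algebra_simps)
  qed
  \<comment> \<open>The definitions take \<open>x\<close> and \<open>y\<close> in either order,
    while \<open>quasi\<close> and \<open>strict\<close> want the exponents sorted.\<close>
  have E_max: "max (E (min x y)) (E (max x y)) = max (E x) (E y)" for x y
    by (cases "x \<le> y") (auto simp: max.commute min_def max_def)
  have "quasiconvex_on {..<0} E"
    unfolding quasiconvex_on_def
  proof (intro ballI)
    fix x y c :: real
    assume "x \<in> {..<0}" "y \<in> {..<0}" "c \<in> {0<..<1}"
    \<comment> \<open>For \<open>x = y\<close> the combination collapses to \<open>x\<close>, a case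
      that \<open>between\<close> leaves out.\<close>
    then show "E (c * x + (1 - c) * y) \<le> max (E x) (E y)"
      using quasi[OF between[of x y c]] E_max[of x y]
      by (cases "x = y") (auto simp: algebra_simps)
  qed
  moreover have "strictly_quasiconvex_on {..<0} E"
    if "\<not> has_max_between_minima T" "\<not> has_min_between_maxima T"
    unfolding strictly_quasiconvex_on_def
    using strict[OF between _ that] E_max by auto
  ultimately show ?thesis
    by (auto simp: E_def)
qed

end
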